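(* Let $X$ be an ordered Banach space whose cone $X_+$ is closed, generating and normal, and let $Y$ be a normed space. Then every $\sigma$-w-Lebesgue operator $T:X\to Y$ is bounded, i.e. $\mathrm{L}^\sigma_{wLeb}(X,Y)\subseteq \mathrm{L}(X,Y)$. In particular, every $\sigma$-order-to-weak continuous operator $T:X\to Y$ is bounded, i.e. $\mathrm{L}^\sigma_{owc}(X,Y)\subseteq \mathrm{L}(X,Y)$.
   Context: Vector spaces are real and operators are linear (not assumed continuous). An ordered vector space $X$ is a real vector space with a cone $X_+$ (a convex cone with $X_+\cap(-X_+)=\{0\}$), ordered by $x\le y$ iff $y-x\in X_+$. An ordered Banach space is a Banach space that is also an ordered vector space. The cone $X_+$ is closed if it is norm closed, generating if $X_+-X_+=X$, and normal if there is a constant $N$ such that $0\le x\le y$ implies $\|x\|\le N\|y\|$. The notation $x_\alpha\downarrow 0$ means that the net $(x_\alpha)$ is decreasing and $\inf_\alpha x_\alpha=0$. A net $(x_\alpha)$ (in particular a sequence) order converges to $0$ if there is a net $g_\beta\downarrow 0$ in $X$ such that for each $\beta$ there is $\alpha_\beta$ with $\pm x_\alpha\le g_\beta$ for all $\alpha\ge\alpha_\beta$. Let $T:X\to Y$ be a linear operator. $T$ is $\sigma$-w-Lebesgue ($T\in\mathrm{L}^\sigma_{wLeb}(X,Y)$) if $Tx_n\to0$ weakly for every sequence $x_n\downarrow0$ in $X$. $T$ is $\sigma$-order-to-weak continuous ($T\in\mathrm{L}^\sigma_{owc}(X,Y)$) if $Tx_n\to0$ weakly for every sequence $(x_n)$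 in $X$ that order converges to $0$. $\mathrm{L}(X,Y)$ is the space of norm bounded (continuous) linear operators from $X$ to $Y$. *)

theory Defs
  imports "HOL-Analysis.Analysis" "HOL-Library.Lub_Glb"
begin

text \<open>
  An ordered vector space is a type of class \<^class>\<open>ordered_real_vector\<close>, its cone
  being the set of elements above \<open>0\<close>. An ordered Banach space is a type of sort
  \<open>{banach, ordered_real_vector}\<close>; that sort does not relate the norm to the order.
\<close>

definition pos_cone :: "'a::ordered_real_vector set" where
  "pos_cone = {x. 0 \<le> x}"

definition generating_cone :: "'a::ordered_real_vector set \<Rightarrow> bool" where
  "generating_cone C \<longleftrightarrow> {u - v | u v. u \<in> C \<and> v \<in> C} = UNIV"

definition normal_cone :: "'a::{real_normed_vector, ordered_real_vector} itself \<Rightarrow> bool" where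
  "normal_cone _ \<longleftrightarrow>
     (\<exists>N::real. \<forall>x y::'a. 0 \<le> x \<and> x \<le> y \<longrightarrow> norm x \<le> N * norm y)"

text \<open>
  A net \<open>g\<close> is indexed by a nonempty set \<open>I\<close> directed by a preorder \<open>r\<close>, where
  \<open>(i, j) \<in> r\<close> means that \<open>j\<close> comes after \<open>i\<close>.
\<close>

definition directed_on :: "'i set \<Rightarrow> ('i \<times> 'i) set \<Rightarrow> bool" where
  "directed_on I r \<longleftrightarrow>
     I \<noteq> {} \<and> preorder_on I r \<and> (\<forall>i\<in>I. \<forall>j\<in>I. \<exists>k\<in>I. (i, k) \<in> r \<and> (j, k) \<in> r)"

definition net_down_zero ::
    "'i set \<Rightarrow> ('i \<times> 'i) set \<Rightarrow> ('i \<Rightarrow> 'a::ordered_real_vector) \<Rightarrow> bool" where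
  "net_down_zero I r g \<longleftrightarrow>
     directed_on I r \<and> (\<forall>i j. (i, j) \<in> r \<longrightarrow> g j \<le> g i) \<and> isGlb UNIV (g ` I) 0"

definition seq_down_zero :: "(nat \<Rightarrow> 'a::ordered_real_vector) \<Rightarrow> bool" where
  "seq_down_zero x \<longleftrightarrow> net_down_zero UNIV {(m, n). m \<le> n} x"

lemma seq_down_zero_iff: "seq_down_zero x \<longleftrightarrow> decseq x \<and> isGlb UNIV (range x) 0"
proof -
  have "preorder_on (UNIV::nat set) {(m, n). m \<le> n}"
    by (auto simp: preorder_on_def refl_on_def trans_def)
  moreover have "\<exists>k. i \<le> k \<and> j \<le> k" for i j :: nat
    by (meson nat_le_linear order_refl)
  ultimately show ?thesis
    by (auto simp: seq_down_zero_def net_down_zero_def directed_on_def decseq_def)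
qed

text \<open>
  HOL cannot quantify existentially over the index type of the dominating net, so
  \<open>order_null_seq\<close> takes its index set inside the space itself. This loses no
  generality: \<open>order_null_seqI\<close> below admits nets over an arbitrary index type.
\<close>

definition dominated_by_net ::
    "'i set \<Rightarrow> ('i \<Rightarrow> 'a::ordered_real_vector) \<Rightarrow> (nat \<Rightarrow> 'a) \<Rightarrow> bool" where
  "dominated_by_net I g x \<longleftrightarrow> (\<forall>b\<in>I. \<exists>n0. \<forall>n\<ge>n0. x n \<le> g b \<and> - x n \<le> g b)"

definition order_null_seq :: "(nat \<Rightarrow> 'a::ordered_real_vector) \<Rightarrow> bool" where
  "order_null_seq x \<longleftrightarrow>
     (\<exists>(I::'a set) r (g::'a \<Rightarrow> 'a). net_down_zero I r g \<and> dominated_by_net I g x)"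

lemma order_null_seqI:
  fixes I :: "'i set" and g :: "'i \<Rightarrow> 'a::ordered_real_vector"
  assumes "net_down_zero I r g" and "dominated_by_net I g x"
  shows "order_null_seq x"
proof -
  define s where "s = {(a, b). a \<in> g ` I \<and> b \<in> g ` I \<and> b \<le> a}"
  have dir: "directed_on I r" and dec: "\<And>i j. (i, j) \<in> r \<Longrightarrow> g j \<le> g i"
    and inf: "isGlb UNIV (g ` I) 0"
    using assms(1) by (auto simp: net_down_zero_def)
  have "preorder_on (g ` I) s"
    by (auto simp: s_def preorder_on_def refl_on_def intro!: transI)
  moreover have "\<exists>k\<in>g ` I. (a, k) \<in> s \<and> (b, k) \<in> s" if ab: "a \<in> g ` I" "b \<in> g ` I" for a b
  proof -
    obtain i j where ij: "i \<in> I" "j \<in> I" "a = g i" "b = g j" using ab by auto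
    then obtain k where "k \<in> I" "(i, k) \<in> r" "(j, k) \<in> r"
      using dir unfolding directed_on_def by blast
    with dec ij show ?thesis by (auto simp: s_def)
  qed
  moreover have "g ` I \<noteq> {}" using dir by (simp add: directed_on_def)
  ultimately have "net_down_zero (g ` I) s (\<lambda>a. a)"
    using inf by (auto simp: net_down_zero_def directed_on_def s_def)
  moreover have "dominated_by_net (g ` I) (\<lambda>a. a) x"
    using assms(2) by (simp add: dominated_by_net_def)
  ultimately show ?thesis
    unfolding order_null_seq_def by blast
qed

definition weakly_null :: "(nat \<Rightarrow> 'b::real_normed_vector) \<Rightarrow> bool" where
  "weakly_null y \<longleftrightarrow>
     (\<forall>f::'b \<Rightarrow> real. bounded_linear f \<longrightarrow> (\<lambda>n. f (y n)) \<longlonglongrightarrow> 0)"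

definition L_sigma_wLeb :: "('a::ordered_real_vector \<Rightarrow> 'b::real_normed_vector) set" where
  "L_sigma_wLeb = {T. linear T \<and> (\<forall>x. seq_down_zero x \<longrightarrow> weakly_null (\<lambda>n. T (x n)))}"

definition L_sigma_owc :: "('a::ordered_real_vector \<Rightarrow> 'b::real_normed_vector) set" where
  "L_sigma_owc = {T. linear T \<and> (\<forall>x. order_null_seq x \<longrightarrow> weakly_null (\<lambda>n. T (x n)))}"

end

theory Submission
  imports Defs
begin

text \<open>
  The proof is a gliding hump argument. If \<open>T\<close> is unbounded on the cone, there are
  \<open>x\<^sub>n \<ge> 0\<close> with \<open>\<parallel>x\<^sub>n\<parallel> = 2\<^sup>-\<^sup>n\<close> and \<open>\<parallel>T x\<^sub>n\<parallel> > 2\<^sup>n\<close>. The tails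
  \<open>z\<^sub>n = x\<^sub>n + x\<^sub>n\<^sub>+\<^sub>1 + \<dots>\<close> form a decreasing sequence that tends to \<open>0\<close> in norm,
  and, because the cone is closed, this forces their infimum to be \<open>0\<close>. So
  \<open>T z\<^sub>n\<close> is weakly null, hence so is \<open>T x\<^sub>n = T z\<^sub>n - T z\<^sub>n\<^sub>+\<^sub>1\<close>. But weakly null sequences are
  norm bounded (\<open>weakly_null_norm_bounded\<close>), a contradiction. This is lemma
  \<open>wLeb_bounded_on_cone\<close>.

  Boundedness on the cone passes to the whole space by a quantitative form of
  \<open>X = X\<^sub>+ - X\<^sub>+\<close> due to Krein and Smulian: every \<open>x\<close> is \<open>u - v\<close> with \<open>u, v \<ge> 0\<close> of norm at
  most \<open>M \<parallel>x\<parallel>\<close> (\<open>bounded_cone_decomposition\<close>). It is proved like the open mapping theorem: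
  Baire's theorem gives bounded decompositions up to a small error, and iterating on the error
  gives exact ones.

  That weakly null sequences are norm bounded is the uniform boundedness principle on the
  Banach space of functionals on \<open>Y\<close>, together with the norming functionals of the Hahn-Banach
  theorem. The latter is obtained from minimal sublinear functionals, an approach
  that needs no extension from subspaces: a minimal sublinear functional is linear.

  Finally, a sequence decreasing to \<open>0\<close> is order null, being dominated by itself, so every
  \<open>\<sigma>\<close>-order-to-weak continuous operator is \<open>\<sigma>\<close>-w-Lebesgue.
\<close>

section \<open>Norming functionals from minimal sublinear functionals\<close>

definition sublinear :: "('b::real_vector \<Rightarrow> real) \<Rightarrow> bool" where
  "sublinear q \<longleftrightarrow> (\<forall>x y. q (x + y) \<le> q x + q y) \<and> (\<forall>c x. 0 \<le> c \<longrightarrow> q (c *\<^sub>R x) = c * q x)"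

lemma sublinear_add: "sublinear q \<Longrightarrow> q (x + y) \<le> q x + q y"
  by (simp add: sublinear_def)

lemma sublinear_scale: "sublinear q \<Longrightarrow> 0 \<le> c \<Longrightarrow> q (c *\<^sub>R x) = c * q x"
  by (simp add: sublinear_def)

lemma sublinear_zero: "sublinear q \<Longrightarrow> q 0 = 0"
  using sublinear_scale[of q 0 0] by simp

lemma sublinear_ge_neg: "sublinear q \<Longrightarrow> - q (- x) \<le> q x"
  using sublinear_add[of q x "- x"] by (simp add: sublinear_zero)

text \<open>
  Homogeneity may be checked as an inequality, since the reverse inequality is the same one for
  the factor \<open>1 / c\<close>.
\<close>

lemma sublinearI:
  assumes add: "\<And>x y. q (x + y) \<le> q x + q y"
    and zero: "q 0 = 0"
    and scale: "\<And>c x. 0 < c \<Longrightarrow> q (c *\<^sub>R x) \<le> c * q x"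
  shows "sublinear q"
proof -
  have "q (c *\<^sub>R x) = c * q x" if "0 \<le> c" for c x
  proof (cases "c = 0")
    case False
    with that have c: "0 < c" by simp
    have "q ((1 / c) *\<^sub>R (c *\<^sub>R x)) \<le> (1 / c) * q (c *\<^sub>R x)"
      using c by (intro scale) simp
    then have "c * q x \<le> q (c *\<^sub>R x)" using c by (simp add: field_simps)
    with scale[OF c, of x] show ?thesis by simp
  qed (simp add: zero)
  with add show ?thesis by (simp add: sublinear_def)
qed

text \<open>
  The largest sublinear functional \<open>\<le> q\<close> whose value at \<open>- y\<close> is at most \<open>- q y\<close>. A functional
  that equals all its tilts is additive; a linear functional below the tilt of the norm
  at \<open>y\<close> takes the value \<open>norm y\<close> at \<open>y\<close>.
\<close>

definition tilt :: "('b::real_vector \<Rightarrow> real) \<Rightarrow> 'b \<Rightarrow> 'b \<Rightarrow> real" where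
  "tilt q y x = (INF t\<in>{0..}. q (x + t *\<^sub>R y) - t * q y)"

lemma tilt_le:
  assumes "sublinear q" and "0 \<le> t"
  shows "tilt q y x \<le> q (x + t *\<^sub>R y) - t * q y"
proof -
  have "- q (- x) \<le> q (x + s *\<^sub>R y) - s * q y" if "0 \<le> s" for s
    using sublinear_add[OF assms(1), of "x + s *\<^sub>R y" "- x"] sublinear_scale[OF assms(1) that, of y]
    by simp
  then have "bdd_below ((\<lambda>t. q (x + t *\<^sub>R y) - t * q y) ` {0..})"
    by (intro bdd_belowI2[where m = "- q (- x)"]) simp
  then show ?thesis unfolding tilt_def using assms(2) by (intro cINF_lower) auto
qed

lemma le_tilt:
  assumes "\<And>t. 0 \<le> t \<Longrightarrow> a \<le> q (x + t *\<^sub>R y) - t * q y"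
  shows "a \<le> tilt q y x"
  unfolding tilt_def using assms by (intro cINF_greatest) auto

lemma tilt_le_self: "sublinear q \<Longrightarrow> tilt q y \<le> q"
  using tilt_le[of q 0] by (auto simp: le_fun_def)

lemma tilt_uminus_le: "sublinear q \<Longrightarrow> tilt q y (- y) \<le> - q y"
  using tilt_le[of q 1 y "- y"] by (simp add: sublinear_zero)

lemma sublinear_tilt:
  assumes q: "sublinear q"
  shows "sublinear (tilt q y)"
proof (rule sublinearI)
  fix x x' :: 'a
  have "tilt q y (x + x') - (q (x' + t *\<^sub>R y) - t * q y) \<le> tilt q y x" if t: "0 \<le> t" for t
  proof (rule le_tilt)
    fix s :: real assume s: "0 \<le> s"
    have "tilt q y (x + x') \<le> q ((x + s *\<^sub>R y) + (x' + t *\<^sub>R y)) - (s + t) * q y"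
      using tilt_le[OF q, of "s + t" y "x + x'"] s t by (simp add: algebra_simps)
    also have "\<dots> \<le> q (x + s *\<^sub>R y) + q (x' + t *\<^sub>R y) - (s + t) * q y"
      using sublinear_add[OF q] by simp
    finally show "tilt q y (x + x') - (q (x' + t *\<^sub>R y) - t * q y) \<le> q (x + s *\<^sub>R y) - s * q y"
      by (simp add: algebra_simps)
  qed
  then have "tilt q y (x + x') - tilt q y x \<le> tilt q y x'"
    by (intro le_tilt) (smt (verit))
  then show "tilt q y (x + x') \<le> tilt q y x + tilt q y x'" by simp
next
  have "0 \<le> tilt q y 0" by (rule le_tilt) (simp add: sublinear_scale[OF q])
  moreover have "tilt q y 0 \<le> 0"
    using tilt_le[OF q, of 0 y 0] by (simp add: sublinear_zero[OF q])
  ultimately show "tilt q y 0 = 0" by simp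
next
  fix c :: real and x :: 'a assume c: "0 < c"
  have "tilt q y (c *\<^sub>R x) / c \<le> tilt q y x"
  proof (rule le_tilt)
    fix t :: real assume t: "0 \<le> t"
    have "tilt q y (c *\<^sub>R x) \<le> q (c *\<^sub>R (x + t *\<^sub>R y)) - (c * t) * q y"
      using tilt_le[OF q, of "c * t" y "c *\<^sub>R x"] c t by (simp add: algebra_simps)
    also have "\<dots> = c * (q (x + t *\<^sub>R y) - t * q y)"
      using c by (simp add: sublinear_scale[OF q] right_diff_distrib)
    finally show "tilt q y (c *\<^sub>R x) / c \<le> q (x + t *\<^sub>R y) - t * q y"
      using c by (simp add: field_simps)
  qed
  then show "tilt q y (c *\<^sub>R x) \<le> c * tilt q y x" using c by (simp add: field_simps)
qed

text \<open>
  Minimality gives \<open>tilt m y = m\<close>, and the instance \<open>t = 1\<close> of the infimum then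
  says \<open>m x + m y \<le> m (x + y)\<close>.
\<close>

lemma minimal_sublinear_linear:
  assumes m: "sublinear m" and min: "\<And>q. sublinear q \<Longrightarrow> q \<le> m \<Longrightarrow> q = m"
  shows "linear m"
proof -
  have add: "m (x + y) = m x + m y" for x y
  proof -
    have "tilt m y = m" using m by (intro min sublinear_tilt tilt_le_self)
    then show ?thesis
      using tilt_le[OF m, of 1 y x] sublinear_add[OF m, of x y] by simp
  qed
  have neg: "m (- x) = - m x" for x
    using add[of x "- x"] sublinear_zero[OF m] by simp
  have "m (c *\<^sub>R x) = c * m x" for c x
  proof (cases "0 \<le> c")
    case False
    then show ?thesis
      using sublinear_scale[OF m, of "- c" x] neg[of "c *\<^sub>R x"] by simp
  qed (simp add: sublinear_scale[OF m])
  with add show ?thesis by (intro linearI) auto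
qed

text \<open>
  The pointwise infimum of a chain is again sublinear: for subadditivity, two members of the
  chain may be replaced by the smaller one.
\<close>

lemma sublinear_INF_chain:
  fixes C :: "('b::real_vector \<Rightarrow> real) set"
  assumes ne: "C \<noteq> {}" and sub: "\<And>q. q \<in> C \<Longrightarrow> sublinear q"
    and below: "\<And>q. q \<in> C \<Longrightarrow> q \<le> p"
    and chain: "\<And>q q'. q \<in> C \<Longrightarrow> q' \<in> C \<Longrightarrow> q \<le> q' \<or> q' \<le> q"
  shows "sublinear (\<lambda>x. INF q\<in>C. q x)" and "q \<in> C \<Longrightarrow> (\<lambda>x. INF q\<in>C. q x) \<le> q"
proof -
  let ?u = "\<lambda>x. INF q\<in>C. q x"
  have "- p (- x) \<le> q x" if "q \<in> C" for q x
    using sublinear_ge_neg[OF sub[OF that], of x] le_funD[OF below[OF that], of "- x"] by linarith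
  then have "bdd_below ((\<lambda>q. q x) ` C)" for x
    by (intro bdd_belowI2) auto
  then have lower: "?u x \<le> q x" if "q \<in> C" for q x
    using that by (intro cINF_lower) auto
  then show "q \<in> C \<Longrightarrow> ?u \<le> q" by (simp add: le_fun_def)
  have greatest: "a \<le> ?u x" if "\<And>q. q \<in> C \<Longrightarrow> a \<le> q x" for a x
    using ne that by (intro cINF_greatest) auto
  show "sublinear ?u"
  proof (rule sublinearI)
    fix x y
    have "?u (x + y) \<le> q x + q' y" if qq: "q \<in> C" "q' \<in> C" for q q'
    proof -
      obtain r where r: "r \<in> C" "r \<le> q" "r \<le> q'" using chain[OF qq] qq by blast
      have "?u (x + y) \<le> r x + r y"
        using lower[OF r(1)] sublinear_add[OF sub[OF r(1)]] by (rule order_trans)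
      with le_funD[OF r(2), of x] le_funD[OF r(3), of y] show ?thesis by linarith
    qed
    then have "?u (x + y) - q x \<le> ?u y" if "q \<in> C" for q
      using that by (intro greatest) (smt (verit))
    then have "?u (x + y) - ?u y \<le> ?u x"
      by (intro greatest) (smt (verit))
    then show "?u (x + y) \<le> ?u x + ?u y" by simp
  next
    have "(\<lambda>q. q 0) ` C = {0}" using ne sublinear_zero[OF sub] by force
    then show "?u 0 = 0" by simp
  next
    fix c :: real and x assume c: "0 < c"
    have "?u (c *\<^sub>R x) / c \<le> ?u x"
    proof (rule greatest)
      fix q assume q: "q \<in> C"
      show "?u (c *\<^sub>R x) / c \<le> q x"
        using lower[OF q, of "c *\<^sub>R x"] sublinear_scale[OF sub[OF q], of c x] c
        by (simp add: field_simps)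
    qed
    then show "?u (c *\<^sub>R x) \<le> c * ?u x" using c by (simp add: field_simps)
  qed
qed

lemma linear_below_sublinear:
  fixes p :: "'b::real_vector \<Rightarrow> real"
  assumes p: "sublinear p"
  obtains f where "linear f" and "f \<le> p"
proof -
  let ?A = "{q. sublinear q \<and> q \<le> p}"
  have "\<exists>m\<in>?A. \<forall>q\<in>?A. q \<le> m \<longrightarrow> q = m"
  proof (rule predicate_Zorn)
    show "partial_order_on ?A (relation_of (\<lambda>a b. b \<le> a) ?A)"
      by (rule partial_order_on_relation_ofI) auto
  next
    fix C assume C: "C \<in> Chains (relation_of (\<lambda>a b. b \<le> a) ?A)"
    then have sub: "sublinear q" and below: "q \<le> p" if "q \<in> C" for q
      using that by (auto simp: Chains_def relation_of_def)
    have chain: "q \<le> q' \<or> q' \<le> q" if "q \<in> C" "q' \<in> C" for q q'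
      using C that by (auto simp: Chains_def relation_of_def)
    show "\<exists>u\<in>?A. \<forall>q\<in>C. u \<le> q"
    proof (cases "C = {}")
      case True
      then show ?thesis using p by auto
    next
      case False
      note INF = sublinear_INF_chain[OF False sub below chain]
      from False obtain q0 where "q0 \<in> C" by blast
      then have "(\<lambda>x. INF q\<in>C. q x) \<le> p" using INF(2) below by (meson order_trans)
      with INF show ?thesis by (intro bexI[where x = "\<lambda>x. INF q\<in>C. q x"]) auto
    qed
  qed
  then obtain m where m: "sublinear m" "m \<le> p"
    and min: "\<And>q. sublinear q \<Longrightarrow> q \<le> p \<Longrightarrow> q \<le> m \<Longrightarrow> q = m" by auto
  have "linear m" using m(1) by (rule minimal_sublinear_linear) (meson m(2) min order_trans)
  with m(2) show thesis by (rule that[rotated])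
qed

lemma norming_functional:
  fixes y :: "'b::real_normed_vector"
  obtains f :: "'b \<Rightarrow>\<^sub>L real" where "norm f \<le> 1" and "blinfun_apply f y = norm y"
proof -
  have sub: "sublinear (norm :: 'b \<Rightarrow> real)"
    by (simp add: sublinear_def norm_triangle_ineq)
  obtain f where f: "linear f" and le: "f \<le> tilt norm y"
    using linear_below_sublinear[OF sublinear_tilt[OF sub]] by blast
  have le_norm: "f x \<le> norm x" for x
    using le tilt_le_self[OF sub, of y] by (meson le_funD order_trans)
  have abs: "\<bar>f x\<bar> \<le> norm x" for x
    using le_norm[of x] le_norm[of "- x"] linear_neg[OF f, of x] by simp
  have "f (- y) \<le> - norm y"
    using le_funD[OF le, of "- y"] tilt_uminus_le[OF sub, of y] by simp
  then have "f y = norm y"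
    using linear_neg[OF f, of y] le_norm[of y] by simp
  moreover have bl: "bounded_linear f"
    using f abs by (intro bounded_linear_intro[where K = 1]) (auto simp: linear_add linear_scale)
  moreover have "norm (Blinfun f) \<le> 1"
    using abs by (intro norm_blinfun_bound) (auto simp: bounded_linear_Blinfun_apply[OF bl])
  ultimately show thesis
    by (intro that[of "Blinfun f"]) (auto simp: bounded_linear_Blinfun_apply)
qed

section \<open>Uniform boundedness\<close>

lemma Baire_closed_cover:
  fixes F :: "nat \<Rightarrow> 'a::{real_normed_vector, complete_space} set"
  assumes closed: "\<And>n. closed (F n)" and cover: "(\<Union>n. F n) = UNIV"
  obtains n a r where "0 < r" and "ball a r \<subseteq> F n"
proof -
  have "\<exists>n. interior (F n) \<noteq> {}"
  proof (rule ccontr)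
    assume "\<not> ?thesis"
    then have "euclidean interior_of \<Union>(range F) = {}"
      using closed completely_metrizable_space_euclidean
      by (intro Baire_category_alt) auto
    with cover show False by simp
  qed
  then show thesis using that by (metis ex_in_conv mem_interior)
qed

text \<open>
  The sequence is pointwise bounded as a family of functionals on the dual space, which is
  complete even if the space itself is not. So it is uniformly bounded there, by
  \<open>4 * m / r\<close> on the unit ball, and evaluating at norming functionals yields the norms.
\<close>

lemma weakly_null_norm_bounded:
  fixes y :: "nat \<Rightarrow> 'b::real_normed_vector"
  assumes "weakly_null y"
  shows "\<exists>K. \<forall>n. norm (y n) \<le> K"
proof -
  define F where "F m = {f :: 'b \<Rightarrow>\<^sub>L real. \<forall>n. \<bar>blinfun_apply f (y n)\<bar> \<le> real m}" for m :: nat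
  have "closed (F m)" for m
    unfolding F_def by (intro closed_Collect_all closed_Collect_le continuous_intros)
  moreover have "(\<Union>m. F m) = UNIV"
  proof (intro equalityI subsetI UNIV_I)
    fix f :: "'b \<Rightarrow>\<^sub>L real"
    have "(\<lambda>n. blinfun_apply f (y n)) \<longlonglongrightarrow> 0"
      using assms by (simp add: weakly_null_def blinfun.bounded_linear_right)
    then have "Bseq (\<lambda>n. blinfun_apply f (y n))"
      by (intro convergent_imp_Bseq convergentI)
    then obtain K where K: "\<And>n. \<bar>blinfun_apply f (y n)\<bar> \<le> K" by (auto simp: Bseq_def)
    obtain m :: nat where "K \<le> real m" using real_arch_simple by blast
    with K have "f \<in> F m" unfolding F_def by (auto intro: order_trans)
    then show "f \<in> (\<Union>m. F m)" by blast
  qed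
  ultimately obtain m g r where r: "0 < r" and ball: "ball g r \<subseteq> F m"
    by (rule Baire_closed_cover)
  have "norm (y n) \<le> 4 * m / r" for n
  proof -
    obtain f where f: "norm f \<le> 1" "blinfun_apply f (y n) = norm (y n)"
      by (rule norming_functional)
    have "norm ((r / 2) *\<^sub>R f) \<le> r / 2 * 1"
      unfolding norm_scaleR using f(1) r by (intro mult_mono) auto
    then have "norm ((r / 2) *\<^sub>R f) < r" using r by linarith
    then have "g + (r / 2) *\<^sub>R f \<in> F m" "g \<in> F m"
      using ball r by (auto simp: subset_iff dist_norm)
    then have "\<bar>blinfun_apply g (y n) + r / 2 * norm (y n)\<bar> \<le> m" "\<bar>blinfun_apply g (y n)\<bar> \<le> m"
      by (auto simp: F_def blinfun.add_left blinfun.scaleR_left f(2) dest: spec[where x = n])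
    then have "r / 2 * norm (y n) \<le> 2 * m" by linarith
    then show ?thesis using r by (simp add: field_simps)
  qed
  then show ?thesis by blast
qed

section \<open>Bounded decompositions along the cone\<close>

lemma closed_cone_limit:
  fixes x :: "nat \<Rightarrow> 'a::{real_normed_vector, ordered_real_vector}"
  assumes "closed (pos_cone :: 'a set)" and "\<And>n. 0 \<le> x n" and "x \<longlonglongrightarrow> l"
  shows "0 \<le> l"
  using closed_sequentially[OF assms(1) _ assms(3)] assms(2) by (simp add: pos_cone_def)

lemma closed_cone_suminf:
  fixes x :: "nat \<Rightarrow> 'a::{real_normed_vector, ordered_real_vector}"
  assumes "closed (pos_cone :: 'a set)" and "\<And>n. 0 \<le> x n" and "summable x"
  shows "0 \<le> suminf x"
  using assms(1) _ summable_LIMSEQ[OF assms(3)]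
  by (rule closed_cone_limit) (simp add: assms(2) sum_nonneg)

text \<open>
  By Baire's theorem some \<open>D n\<close> is dense in a ball \<open>ball a r\<close>. Points near \<open>0\<close> are
  differences of points of that ball, so they are approximated by elements of \<open>D n - D n\<close>, and
  homogeneity extends this to all points.
\<close>

lemma approximate_cone_decomposition:
  assumes gen: "generating_cone (pos_cone :: 'a::{banach, ordered_real_vector} set)"
  shows "\<exists>K. \<forall>x::'a. \<exists>u v. 0 \<le> u \<and> 0 \<le> v \<and> norm u \<le> K * norm x \<and> norm v \<le> K * norm x
    \<and> norm (x - (u - v)) \<le> norm x / 2"
proof -
  define D where "D n = {u - v | u v :: 'a. 0 \<le> u \<and> 0 \<le> v \<and> norm u \<le> real n \<and> norm v \<le> real n}"
    for n :: nat
  have "(\<Union>n. closure (D n)) = UNIV"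
  proof (intro equalityI subsetI UNIV_I)
    fix x :: 'a
    have "x \<in> {u - v | u v. u \<in> pos_cone \<and> v \<in> pos_cone}"
      using gen by (simp add: generating_cone_def)
    then obtain u v :: 'a where uv: "0 \<le> u" "0 \<le> v" "x = u - v"
      by (auto simp: pos_cone_def)
    obtain n :: nat where "max (norm u) (norm v) \<le> real n" using real_arch_simple by blast
    with uv have "x \<in> D n" by (auto simp: D_def)
    then show "x \<in> (\<Union>n. closure (D n))" using closure_subset by blast
  qed
  with closed_closure obtain n a r where r: "0 < r" and ball: "ball a r \<subseteq> closure (D n)"
    by (rule Baire_closed_cover)
  have small: "\<exists>u v. 0 \<le> u \<and> 0 \<le> v \<and> norm u \<le> 2 * real n \<and> norm v \<le> 2 * real n \<and> norm (x - (u - v)) < e"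
    if x: "norm x < r" and e: "0 < e" for x :: 'a and e :: real
  proof -
    have "a + x \<in> closure (D n)" "a \<in> closure (D n)"
      using ball x r by (auto simp: subset_iff dist_norm)
    then obtain d d' where d: "d \<in> D n" "dist d (a + x) < e / 2" "d' \<in> D n" "dist d' a < e / 2"
      using e unfolding closure_approachable by (meson half_gt_zero)
    then obtain u v u' v' where uv: "d = u - v" "0 \<le> u" "0 \<le> v" "norm u \<le> n" "norm v \<le> n"
      "d' = u' - v'" "0 \<le> u'" "0 \<le> v'" "norm u' \<le> n" "norm v' \<le> n"
      by (auto simp: D_def)
    have "norm ((a + x - d) + (d' - a)) < e"
      using d(2,4) norm_triangle_ineq[of "a + x - d" "d' - a"]
      by (simp add: dist_norm norm_minus_commute)
    then have "norm (x - ((u + v') - (v + u'))) < e" by (simp add: uv algebra_simps)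
    moreover have "norm (u + v') \<le> 2 * real n" "norm (v + u') \<le> 2 * real n"
      using uv norm_triangle_ineq[of u v'] norm_triangle_ineq[of v u'] by linarith+
    ultimately show ?thesis
      using uv by (intro exI[of _ "u + v'"] exI[of _ "v + u'"]) auto
  qed
  have "\<exists>u v. 0 \<le> u \<and> 0 \<le> v \<and> norm u \<le> 4 * real n / r * norm x \<and> norm v \<le> 4 * real n / r * norm x
    \<and> norm (x - (u - v)) \<le> norm x / 2" for x :: 'a
  proof (cases "x = 0")
    case True
    then show ?thesis by (intro exI[of _ 0]) auto
  next
    case False
    \<comment> \<open>This scales \<open>x\<close> to norm \<open>r / 2\<close>, so an error of \<open>r / 4\<close> becomes half of \<open>norm x\<close>.\<close>
    define c where "c = r / (2 * norm x)"
    have c: "0 < c" using False r by (simp add: c_def)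
    have "norm (c *\<^sub>R x) < r" using False r by (simp add: c_def)
    moreover have "0 < r / 4" using r by simp
    ultimately obtain u v where uv: "0 \<le> u" "0 \<le> v" "norm u \<le> 2 * real n" "norm v \<le> 2 * real n"
      "norm (c *\<^sub>R x - (u - v)) < r / 4"
      using small by blast
    have "x - ((1 / c) *\<^sub>R u - (1 / c) *\<^sub>R v) = (1 / c) *\<^sub>R (c *\<^sub>R x - (u - v))"
      using c by (simp add: algebra_simps)
    then have "norm (x - ((1 / c) *\<^sub>R u - (1 / c) *\<^sub>R v)) = norm (c *\<^sub>R x - (u - v)) / c"
      using c by simp
    also have "\<dots> \<le> (r / 4) / c" using uv(5) c by (intro divide_right_mono) auto
    also have "\<dots> = norm x / 2" using False r by (simp add: c_def)
    finally have err: "norm (x - ((1 / c) *\<^sub>R u - (1 / c) *\<^sub>R v)) \<le> norm x / 2" .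
    have "norm ((1 / c) *\<^sub>R w) \<le> 4 * real n / r * norm x" if "norm w \<le> 2 * real n" for w :: 'a
    proof -
      have "norm ((1 / c) *\<^sub>R w) \<le> (2 * real n) / c"
        using that c by (simp add: divide_right_mono)
      also have "\<dots> = 4 * real n / r * norm x" using False r by (simp add: c_def)
      finally show ?thesis .
    qed
    with uv err c show ?thesis
      by (intro exI[of _ "(1 / c) *\<^sub>R u"] exI[of _ "(1 / c) *\<^sub>R v"])
        (auto intro!: scaleR_nonneg_nonneg)
  qed
  then show ?thesis by (intro exI[where x = "4 * real n / r"] allI)
qed

text \<open>
  The errors \<open>z k\<close> of successive approximations halve each time, so the approximations form two
  absolutely convergent series of positive elements whose difference telescopes to \<open>x\<close>.
\<close>

lemma bounded_cone_decomposition: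
  assumes clo: "closed (pos_cone :: 'a::{banach, ordered_real_vector} set)"
    and gen: "generating_cone (pos_cone :: 'a set)"
  shows "\<exists>M. \<forall>x::'a. \<exists>u v. 0 \<le> u \<and> 0 \<le> v \<and> x = u - v
    \<and> norm u \<le> M * norm x \<and> norm v \<le> M * norm x"
proof -
  obtain K where K: "\<forall>x::'a. \<exists>u v. 0 \<le> u \<and> 0 \<le> v \<and> norm u \<le> K * norm x
    \<and> norm v \<le> K * norm x \<and> norm (x - (u - v)) \<le> norm x / 2"
    using approximate_cone_decomposition[OF gen] by (rule exE)
  define Q where "Q x u v \<longleftrightarrow> 0 \<le> u \<and> 0 \<le> v \<and> norm u \<le> K * norm x
    \<and> norm v \<le> K * norm x \<and> norm (x - (u - v)) \<le> norm x / 2" for x u v :: 'a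
  have "\<exists>u v. Q x u v" for x
    unfolding Q_def using K by (rule spec)
  then obtain U V where UV: "\<And>x. Q x (U x) (V x)" by metis
  have pos: "\<And>x. 0 \<le> U x" "\<And>x. 0 \<le> V x"
    and bd: "\<And>x. norm (U x) \<le> K * norm x" "\<And>x. norm (V x) \<le> K * norm x"
    and err: "\<And>x. norm (x - (U x - V x)) \<le> norm x / 2"
    using UV by (simp_all add: Q_def)
  have "\<exists>u v. 0 \<le> u \<and> 0 \<le> v \<and> x = u - v
    \<and> norm u \<le> (2 * \<bar>K\<bar>) * norm x \<and> norm v \<le> (2 * \<bar>K\<bar>) * norm x" for x :: 'a
  proof -
    define z where "z k = ((\<lambda>x. x - (U x - V x)) ^^ k) x" for k
    have z0: "z 0 = x" and zS: "z (Suc k) = z k - (U (z k) - V (z k))" for k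
      by (simp_all add: z_def)
    have nz: "norm (z k) \<le> norm x * (1 / 2) ^ k" for k
    proof (induction k)
      case (Suc k)
      have "norm (z (Suc k)) \<le> norm (z k) / 2" unfolding zS by (rule err)
      with Suc show ?case by simp
    qed (simp add: z0)
    have series: "summable (\<lambda>k. W (z k))" "0 \<le> (\<Sum>k. W (z k))"
      "norm (\<Sum>k. W (z k)) \<le> (2 * \<bar>K\<bar>) * norm x"
      if W: "\<And>x. 0 \<le> W x" "\<And>x. norm (W x) \<le> K * norm x" for W :: "'a \<Rightarrow> 'a"
    proof -
      have le: "norm (W (z k)) \<le> (\<bar>K\<bar> * norm x) * (1 / 2) ^ k" for k
      proof -
        have "norm (W (z k)) \<le> \<bar>K\<bar> * norm (z k)"
          using W(2)[of "z k"] mult_right_mono[OF abs_ge_self[of K] norm_ge_zero[of "z k"]]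
          by linarith
        also have "\<dots> \<le> \<bar>K\<bar> * (norm x * (1 / 2) ^ k)" using nz by (intro mult_left_mono) auto
        finally show ?thesis by (simp add: mult.assoc)
      qed
      have geo: "(\<lambda>k. (\<bar>K\<bar> * norm x) * (1 / 2) ^ k) sums (\<bar>K\<bar> * norm x * 2)"
        using sums_mult[OF geometric_sums[of "1 / 2 :: real"], of "\<bar>K\<bar> * norm x"] by simp
      show sm: "summable (\<lambda>k. W (z k))"
        using le by (intro summable_comparison_test'[OF sums_summable[OF geo]]) auto
      show "0 \<le> (\<Sum>k. W (z k))" using clo W(1) sm by (rule closed_cone_suminf)
      show "norm (\<Sum>k. W (z k)) \<le> (2 * \<bar>K\<bar>) * norm x"
        using norm_suminf_le[OF le sums_summable[OF geo]] sums_unique[OF geo] by (simp add: mult_ac)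
    qed
    have "z \<longlonglongrightarrow> 0"
    proof (rule Lim_null_comparison)
      show "\<forall>\<^sub>F k in sequentially. norm (z k) \<le> norm x * (1 / 2) ^ k" using nz by simp
      show "(\<lambda>k. norm x * (1 / 2) ^ k) \<longlonglongrightarrow> 0"
        by (intro tendsto_mult_right_zero LIMSEQ_power_zero) simp
    qed
    then have "(\<lambda>k. U (z k) - V (z k)) sums x"
      using telescope_sums'[of z 0] by (simp add: z0 zS)
    then have "x = (\<Sum>k. U (z k) - V (z k))" by (rule sums_unique)
    also have "\<dots> = (\<Sum>k. U (z k)) - (\<Sum>k. V (z k))"
      by (rule suminf_diff[OF series(1)[OF pos(1) bd(1)] series(1)[OF pos(2) bd(2)], symmetric])
    finally have "x = (\<Sum>k. U (z k)) - (\<Sum>k. V (z k))" .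
    with series(2,3)[OF pos(1) bd(1)] series(2,3)[OF pos(2) bd(2)] show ?thesis by blast
  qed
  then show ?thesis by (intro exI[where x = "2 * \<bar>K\<bar>"] allI)
qed

section \<open>The gliding hump\<close>

text \<open>
  A lower bound \<open>w\<close> of the tails \<open>z n\<close> puts every \<open>z n - w\<close> into the cone; their norm limit
  \<open>- w\<close> then lies in the cone as well, so \<open>w \<le> 0\<close>.
\<close>

lemma tails_seq_down_zero:
  fixes x :: "nat \<Rightarrow> 'a::{real_normed_vector, ordered_real_vector}"
  assumes clo: "closed (pos_cone :: 'a set)" and pos: "\<And>n. 0 \<le> x n" and sm: "summable x"
  shows "seq_down_zero (\<lambda>n. \<Sum>k. x (k + n))"
proof -
  let ?z = "\<lambda>n. \<Sum>k. x (k + n)"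
  have smn: "summable (\<lambda>k. x (k + n))" for n using sm by (rule summable_ignore_initial_segment)
  have z_eq: "?z n = suminf x - sum x {..<n}" for n
    using sm by (rule suminf_minus_initial_segment)
  have "decseq ?z"
    unfolding z_eq by (rule decseq_SucI) (simp add: pos)
  moreover have "isGlb UNIV (range ?z) 0"
  proof (rule isGlbI2)
    show "isLb UNIV (range ?z) 0"
      using closed_cone_suminf[OF clo pos smn] by (auto simp: isLb_def setge_def)
    have "?z \<longlonglongrightarrow> suminf x - suminf x"
      unfolding z_eq by (intro tendsto_diff tendsto_const summable_LIMSEQ sm)
    then have lim: "?z \<longlonglongrightarrow> 0" by simp
    have "w \<le> 0" if w: "isLb UNIV (range ?z) w" for w
    proof -
      have "w \<le> ?z n" for n using w by (auto simp: isLb_def setge_def)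
      then have "0 \<le> ?z n - w" for n by (simp only: diff_ge_0_iff_ge)
      moreover have "(\<lambda>n. ?z n - w) \<longlonglongrightarrow> 0 - w" by (intro tendsto_diff lim tendsto_const)
      ultimately have "0 \<le> 0 - w" by (rule closed_cone_limit[OF clo])
      then show ?thesis by simp
    qed
    then show "Collect (isLb UNIV (range ?z)) *<= 0" by (simp add: setle_def)
  qed
  ultimately show ?thesis by (simp add: seq_down_zero_iff)
qed

text \<open>
  A single term of the series is a difference of two consecutive tails. Hence a hypothesis about
  sequences decreasing to \<open>0\<close> controls a sequence of positive vectors that need not be
  monotone, and these can be chosen to exhibit the unboundedness of \<open>T\<close>.
\<close>

lemma wLeb_bounded_on_cone:
  fixes T :: "'a::{banach, ordered_real_vector} \<Rightarrow> 'b::real_normed_vector"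
  assumes clo: "closed (pos_cone :: 'a set)" and T: "T \<in> L_sigma_wLeb"
  shows "\<exists>K. \<forall>x\<ge>0. norm (T x) \<le> K * norm x"
proof (rule ccontr)
  assume unbdd: "\<not> ?thesis"
  have lin: "linear T" using T by (simp add: L_sigma_wLeb_def)
  have "\<exists>x\<ge>0. norm x = (1 / 2) ^ n \<and> 2 ^ n < norm (T x)" for n :: nat
  proof -
    \<comment> \<open>The factor \<open>4\<^sup>n\<close> pays for both the norm \<open>2\<^sup>-\<^sup>n\<close> and the growth \<open>2\<^sup>n\<close>.\<close>
    obtain w where w: "0 \<le> w" "4 ^ n * norm w < norm (T w)"
      using unbdd by (meson not_le)
    have w0: "w \<noteq> 0" using w(2) linear_0[OF lin] by auto
    define c where "c = (1 / 2) ^ n / norm w"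
    have c: "0 < c" using w0 by (simp add: c_def)
    have four: "(4::real) ^ n = 2 ^ n * 2 ^ n" by (simp flip: power_mult_distrib)
    have "2 ^ n = c * (4 ^ n * norm w)" using w0 by (simp add: c_def four power_divide)
    also have "\<dots> < c * norm (T w)" using w(2) c by simp
    also have "\<dots> = norm (T (c *\<^sub>R w))" using c by (simp add: linear_scale[OF lin])
    finally have "2 ^ n < norm (T (c *\<^sub>R w))" .
    moreover have "norm (c *\<^sub>R w) = (1 / 2) ^ n" using w0 by (simp add: c_def)
    moreover have "0 \<le> c *\<^sub>R w" using c w(1) by (intro scaleR_nonneg_nonneg) auto
    ultimately show ?thesis by blast
  qed
  then obtain x where pos: "\<And>n. 0 \<le> x n" and nx: "\<And>n. norm (x n) = (1 / 2) ^ n"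
    and big: "\<And>n. 2 ^ n < norm (T (x n))" by metis
  have sm: "summable x"
    by (rule summable_norm_cancel) (simp add: nx summable_geometric)
  define z where "z n = (\<Sum>k. x (k + n))" for n
  have "x n = z n - z (Suc n)" for n
    unfolding z_def suminf_minus_initial_segment[OF sm] by simp
  then have diff: "T (x n) = T (z n) - T (z (Suc n))" for n
    by (simp add: linear_diff[OF lin])
  have "seq_down_zero z"
    unfolding z_def using clo pos sm by (rule tails_seq_down_zero)
  then have wz: "weakly_null (\<lambda>n. T (z n))" using T by (simp add: L_sigma_wLeb_def)
  have "weakly_null (\<lambda>n. T (x n))"
    unfolding weakly_null_def
  proof (intro allI impI)
    fix f :: "'b \<Rightarrow> real" assume f: "bounded_linear f"
    have lim: "(\<lambda>n. f (T (z n))) \<longlonglongrightarrow> 0" using wz f by (simp add: weakly_null_def)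
    then have "(\<lambda>n. f (T (z n)) - f (T (z (Suc n)))) \<longlonglongrightarrow> 0 - 0"
      by (intro tendsto_diff LIMSEQ_Suc)
    then show "(\<lambda>n. f (T (x n))) \<longlonglongrightarrow> 0"
      by (simp add: diff linear_diff[OF bounded_linear.linear[OF f]])
  qed
  then obtain K where K: "\<And>n. norm (T (x n)) \<le> K"
    using weakly_null_norm_bounded by blast
  obtain n :: nat where "K < 2 ^ n" using real_arch_pow[of 2 K] by auto
  with K[of n] big[of n] show False by linarith
qed

lemma wLeb_bounded_linear:
  fixes T :: "'a::{banach, ordered_real_vector} \<Rightarrow> 'b::real_normed_vector"
  assumes clo: "closed (pos_cone :: 'a set)" and gen: "generating_cone (pos_cone :: 'a set)"
    and T: "T \<in> L_sigma_wLeb"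
  shows "bounded_linear T"
proof -
  have lin: "linear T" using T by (simp add: L_sigma_wLeb_def)
  obtain K where K: "\<And>x. 0 \<le> x \<Longrightarrow> norm (T x) \<le> K * norm x"
    using wLeb_bounded_on_cone[OF clo T] by blast
  obtain M where M: "\<forall>x::'a. \<exists>u v. 0 \<le> u \<and> 0 \<le> v \<and> x = u - v
    \<and> norm u \<le> M * norm x \<and> norm v \<le> M * norm x"
    using bounded_cone_decomposition[OF clo gen] by (rule exE)
  have pos: "norm (T u) \<le> \<bar>K\<bar> * (M * norm x)" if "0 \<le> u" "norm u \<le> M * norm x" for u x
  proof -
    have "norm (T u) \<le> \<bar>K\<bar> * norm u"
      using K[OF that(1)] mult_right_mono[OF abs_ge_self[of K] norm_ge_zero[of u]] by linarith
    also have "\<dots> \<le> \<bar>K\<bar> * (M * norm x)" using that(2) by (intro mult_left_mono) auto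
    finally show ?thesis .
  qed
  have "norm (T x) \<le> norm x * (2 * \<bar>K\<bar> * M)" for x
  proof -
    obtain u v where uv: "0 \<le> u" "0 \<le> v" "x = u - v" "norm u \<le> M * norm x" "norm v \<le> M * norm x"
      using M by blast
    have "norm (T x) \<le> norm (T u) + norm (T v)"
      unfolding uv(3) linear_diff[OF lin] by (rule norm_triangle_ineq4)
    also have "\<dots> \<le> \<bar>K\<bar> * (M * norm x) + \<bar>K\<bar> * (M * norm x)"
      using uv by (intro add_mono pos)
    finally show ?thesis by (simp add: algebra_simps)
  qed
  with lin show ?thesis
    by (intro bounded_linear_intro) (auto simp: linear_add linear_scale)
qed

lemma seq_down_zero_imp_order_null:
  assumes "seq_down_zero x"
  shows "order_null_seq x"
proof (rule order_null_seqI)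
  show "net_down_zero UNIV {(m, n). m \<le> n} x" using assms by (simp add: seq_down_zero_def)
  have dec: "decseq x" and nonneg: "0 \<le> x n" for n
    using assms by (auto simp: seq_down_zero_iff dest: isGlbD2)
  have "x n \<le> x b \<and> - x n \<le> x b" if "b \<le> n" for b n
    using decseqD[OF dec that] nonneg[of n] nonneg[of b] by (meson neg_le_0_iff_le order_trans)
  then show "dominated_by_net UNIV x x" by (auto simp: dominated_by_net_def)
qed

lemma owc_subset_wLeb: "L_sigma_owc \<subseteq> L_sigma_wLeb"
  by (auto simp: L_sigma_owc_def L_sigma_wLeb_def seq_down_zero_imp_order_null)

theorem theorem2p2:
  assumes "closed (pos_cone :: 'a::{banach, ordered_real_vector} set)"
    and "generating_cone (pos_cone :: 'a set)"
    and "normal_cone TYPE('a)"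
  shows "(L_sigma_wLeb :: ('a \<Rightarrow> 'b::real_normed_vector) set) \<subseteq> {T. bounded_linear T}
    \<and> (L_sigma_owc :: ('a \<Rightarrow> 'b) set) \<subseteq> {T. bounded_linear T}"
  using wLeb_bounded_linear[OF assms(1,2)] owc_subset_wLeb by blast

end
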